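(* Let $A\subset\mathbb Z^n$ be a finite set with $0\in A$ such that $A$ generates $\mathbb Z^n$ as a $\mathbb Z$-module. There exists a constant $N_A$ such that for every integer $N\geq N_A$, $$NA = (NH(A)\cap \mathbb Z^n) \setminus \mathcal E_N(A), \quad\text{where}\quad \mathcal E_N(A):= \mathcal E(A)\cup \bigcup_{a\in A} \big(aN-\mathcal E(a-A) \big).$$
   Context: For an integer $N\ge1$, $NA=\{a_1+\cdots+a_N: a_i\in A\}$ (repetitions allowed). For a finite set $X\subset\mathbb Z^n$: $H(X)=\{\sum_{x\in X} c_x x: c_x\ge 0, \sum_x c_x=1\}$ is its convex hull, $NH(X)=\{Ny: y\in H(X)\}$; $C_X=\{\sum_{x\in X}c_x x: c_x\ge0\}$ is the cone it generates; $\mathcal P(X)=\{\sum_{x\in X} n_x x: n_x\in\mathbb Z_{\ge0}\}$; and the exceptional set is $\mathcal E(X)=(C_X\cap\mathbb Z^n)\setminus\mathcal P(X)$. For $a\in A$, $a-A=\{a-x: x\in A\}$, and for $v\in\mathbb Z^n$ and a set $Y$, $v-Y=\{v-y:y\in Y\}$. *)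

theory Defs
  imports "HOL-Analysis.Analysis"
begin

text \<open>The lattice of integer points is kept inside Euclidean space, so that all sets below
  (sumsets, hulls, cones, exceptional sets) live in one type.\<close>

definition int_lattice :: "(real ^ 'n) set" where
  "int_lattice = {v. \<forall>i. v $ i \<in> \<int>}"

text \<open>Euclidean space as a module over the integers; \<open>int_module.span X\<close> is the
  subgroup generated by \<open>X\<close>.\<close>

interpretation int_module: module "\<lambda>(k::int) (v::real ^ 'n). real_of_int k *\<^sub>R v"
  by unfold_locales (simp_all add: scaleR_right_distrib scaleR_left_distrib)

definition sumset :: "nat \<Rightarrow> (real ^ 'n) set \<Rightarrow> (real ^ 'n) set" where
  "sumset N A = {\<Sum>i<N. a i | a. \<forall>i<N. a i \<in> A}"

text \<open>The next three definitions are meant for finite \<open>X\<close> only (a sum over an infinite set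
  is zero by convention).\<close>

definition gen_cone :: "(real ^ 'n) set \<Rightarrow> (real ^ 'n) set" where
  "gen_cone X = {\<Sum>x\<in>X. c x *\<^sub>R x | c. \<forall>x\<in>X. c x \<ge> (0::real)}"

definition nat_comb :: "(real ^ 'n) set \<Rightarrow> (real ^ 'n) set" where
  "nat_comb X = {\<Sum>x\<in>X. real (m x) *\<^sub>R x | m. True}"

definition exceptional :: "(real ^ 'n) set \<Rightarrow> (real ^ 'n) set" where
  "exceptional X = (gen_cone X \<inter> int_lattice) - nat_comb X"

definition exceptional_level :: "nat \<Rightarrow> (real ^ 'n) set \<Rightarrow> (real ^ 'n) set" where
  "exceptional_level N A =
     exceptional A \<union>
     (\<Union>a\<in>A. (\<lambda>y. real N *\<^sub>R a - y) ` exceptional ((\<lambda>x. a - x) ` A))"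

end

theory Submission
  imports Defs
begin

text \<open>
  Write a lattice point of \<open>N H(A)\<close> as \<open>v = \<Sum>c\<^sub>a a\<close> with \<open>c\<^sub>a \<ge> 0\<close>, \<open>\<Sum>c\<^sub>a = N\<close>, and put
  \<open>m\<^sub>a = \<lfloor>c\<^sub>a\<rfloor>\<close>. The remainders \<open>r = v - \<Sum>m\<^sub>a a\<close> and \<open>s = N - \<Sum>m\<^sub>a\<close> take only finitely many
  values. For fixed \<open>(r, s)\<close> the set \<open>T\<close> of all \<open>m\<close> such that \<open>r + \<Sum>m\<^sub>a a\<close> is a sum of
  \<open>s + \<Sum>m\<^sub>a\<close> elements of \<open>A\<close> is upward closed, so by Dickson's lemma it is
  generated by finitely many elements; let \<open>M\<close> bound their entries. If \<open>N\<close> is large, some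
  \<open>m\<^sub>b \<ge> M\<close>. That \<open>N b - v\<close> is not exceptional for \<open>b - A\<close> means that \<open>m + k e\<^sub>b \<in> T\<close> for some
  \<open>k\<close>; a generator of \<open>T\<close> below \<open>m + k e\<^sub>b\<close> is then already below \<open>m\<close>, so \<open>m \<in> T\<close>.
\<close>

section \<open>Dickson's lemma and stabilisation of upward closed sets\<close>

text \<open>Induction on \<open>I\<close>. Let \<open>F\<close> generate \<open>T\<close> with
  respect to the old coordinates and let \<open>K\<close> bound \<open>t i\<close> on
  \<open>F\<close>. If \<open>m i \<ge> K\<close>, the element of \<open>F\<close> below
  \<open>m\<close> is also below it at \<open>i\<close>. Each of the finitely many slices
  \<open>m i = j\<close> with \<open>j < K\<close> gets its own generators from the induction
  hypothesis, applied to the slice instead of \<open>T\<close>.\<close>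

lemma Dickson_finite_basis:
  fixes T :: "('a \<Rightarrow> nat) set"
  assumes "finite I"
  shows "\<exists>F. finite F \<and> F \<subseteq> T \<and> (\<forall>m\<in>T. \<exists>t\<in>F. \<forall>i\<in>I. t i \<le> m i)"
  using assms
proof (induction I arbitrary: T rule: finite_induct)
  case empty
  show ?case
  proof (cases "T = {}")
    case False
    then obtain t where "t \<in> T" by blast
    then show ?thesis by (intro exI[of _ "{t}"]) auto
  qed auto
next
  case (insert i I)
  obtain F where F: "finite F" "F \<subseteq> T" "\<forall>m\<in>T. \<exists>t\<in>F. \<forall>j\<in>I. t j \<le> m j"
    using insert.IH[of T] by blast
  obtain K where K: "\<forall>t\<in>F. t i \<le> K"
    using finite_nat_set_iff_bounded_le[of "(\<lambda>t. t i) ` F"] F(1) by blast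
  have "\<forall>j. \<exists>G. finite G \<and> G \<subseteq> {m\<in>T. m i = j} \<and>
          (\<forall>m\<in>{m\<in>T. m i = j}. \<exists>t\<in>G. \<forall>l\<in>I. t l \<le> m l)"
    by (intro allI insert.IH)
  from choice[OF this] obtain G where G0: "\<forall>j. finite (G j) \<and> G j \<subseteq> {m\<in>T. m i = j} \<and>
      (\<forall>m\<in>{m\<in>T. m i = j}. \<exists>t\<in>G j. \<forall>l\<in>I. t l \<le> m l)"
    by (elim exE)
  have G: "finite (G j)" "G j \<subseteq> {m\<in>T. m i = j}"
    "m \<in> T \<Longrightarrow> m i = j \<Longrightarrow> \<exists>t\<in>G j. \<forall>l\<in>I. t l \<le> m l" for j m
    using G0 by simp_all
  have "\<exists>t\<in>F \<union> (\<Union>j<K. G j). \<forall>l\<in>insert i I. t l \<le> m l" if m: "m \<in> T" for m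
  proof (cases "m i < K")
    case True
    obtain t where t: "t \<in> G (m i)" "\<forall>l\<in>I. t l \<le> m l" using G(3)[OF m refl] by blast
    moreover have "t i = m i" using t(1) G(2) by blast
    ultimately show ?thesis using True by (intro bexI[of _ t]) auto
  next
    case False
    obtain t where t: "t \<in> F" "\<forall>l\<in>I. t l \<le> m l" using F(3) m by blast
    moreover have "t i \<le> m i" using K t(1) False by fastforce
    ultimately show ?thesis by (intro bexI[of _ t]) auto
  qed
  moreover have "finite (F \<union> (\<Union>j<K. G j))" "F \<union> (\<Union>j<K. G j) \<subseteq> T"
    using F(1,2) G(1,2) by (simp, blast)
  ultimately show ?case by blast
qed

text \<open>With \<open>M\<close> bounding all entries of the generators, a generator puts no
  further constraint on coordinate \<open>b\<close> once \<open>m b \<ge> M\<close>, so raising that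
  coordinate cannot create membership.\<close>

lemma up_closed_stabilises:
  fixes T :: "('a \<Rightarrow> nat) set"
  assumes I: "finite I" and up: "\<And>t m. t \<in> T \<Longrightarrow> (\<forall>i\<in>I. t i \<le> m i) \<Longrightarrow> m \<in> T"
  shows "\<exists>M. \<forall>m. \<forall>b\<in>I. \<forall>k. M \<le> m b \<longrightarrow> m(b := m b + k) \<in> T \<longrightarrow> m \<in> T"
proof -
  obtain F where F: "finite F" "F \<subseteq> T" "\<forall>m\<in>T. \<exists>t\<in>F. \<forall>i\<in>I. t i \<le> m i"
    using Dickson_finite_basis[OF I, of T] by blast
  obtain M where M: "\<forall>t\<in>F. \<forall>i\<in>I. t i \<le> M"
    using finite_nat_set_iff_bounded_le[of "\<Union>t\<in>F. t ` I"] F(1) I by auto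
  have "m \<in> T" if "b \<in> I" "M \<le> m b" "m(b := m b + k) \<in> T" for m b k
  proof -
    obtain t where t: "t \<in> F" "\<forall>i\<in>I. t i \<le> (m(b := m b + k)) i"
      using F(3) \<open>m(b := m b + k) \<in> T\<close> by blast
    have "t i \<le> m i" if "i \<in> I" for i
    proof (cases "i = b")
      case True
      then show ?thesis using M t(1) \<open>b \<in> I\<close> \<open>M \<le> m b\<close> by fastforce
    next
      case False
      then show ?thesis using t(2) that by (metis fun_upd_other)
    qed
    then show ?thesis using up F(2) t(1) by blast
  qed
  then show ?thesis by blast
qed

section \<open>Lattice points\<close>

text \<open>The norm bounds every coordinate, so each such vector is a function from the finite
  index type into a finite set of integers.\<close>

lemma finite_int_lattice_bounded: "finite {v \<in> int_lattice :: (real ^ 'n) set. norm v \<le> R}"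
proof -
  let ?K = "{x \<in> \<int>. \<bar>x\<bar> \<le> R}"
  have "finite ?K" by (rule finite_abs_int_segment)
  then have "finite (vec_lambda ` (UNIV \<rightarrow>\<^sub>E ?K :: ('n \<Rightarrow> real) set))"
    by (intro finite_imageI finite_PiE) auto
  moreover have "{v \<in> int_lattice :: (real ^ 'n) set. norm v \<le> R}
      \<subseteq> vec_lambda ` (UNIV \<rightarrow>\<^sub>E ?K)"
  proof
    fix v :: "real ^ 'n"
    assume v: "v \<in> {v \<in> int_lattice. norm v \<le> R}"
    have "\<bar>v $ i\<bar> \<le> R" for i
      using component_le_norm_cart[of v i] v by simp
    then have "vec_nth v \<in> UNIV \<rightarrow>\<^sub>E ?K"
      using v by (auto simp: int_lattice_def)
    then show "v \<in> vec_lambda ` (UNIV \<rightarrow>\<^sub>E ?K)"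
      by (intro image_eqI[of _ _ "vec_nth v"]) (simp_all add: vec_nth_inverse)
  qed
  ultimately show ?thesis by (rule rev_finite_subset)
qed

lemma int_lattice_diff: "v \<in> int_lattice \<Longrightarrow> w \<in> int_lattice \<Longrightarrow> v - w \<in> int_lattice"
  by (auto simp: int_lattice_def)

lemma int_lattice_scale: "v \<in> int_lattice \<Longrightarrow> real n *\<^sub>R v \<in> int_lattice"
  by (auto simp: int_lattice_def)

lemma int_lattice_sum: "(\<And>x. x \<in> X \<Longrightarrow> f x \<in> int_lattice) \<Longrightarrow> sum f X \<in> int_lattice"
  by (auto simp: int_lattice_def sum_component)

section \<open>Sumsets as nonnegative integer combinations\<close>

lemma sumset_0 [simp]: "sumset 0 A = {0}"
  by (auto simp: sumset_def)

lemma sumset_Suc: "v \<in> sumset (Suc N) A \<longleftrightarrow> (\<exists>w\<in>sumset N A. \<exists>a\<in>A. v = w + a)"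
proof
  assume "v \<in> sumset (Suc N) A"
  then show "\<exists>w\<in>sumset N A. \<exists>a\<in>A. v = w + a"
    unfolding sumset_def by fastforce
next
  assume "\<exists>w\<in>sumset N A. \<exists>a\<in>A. v = w + a"
  then obtain f a where f: "\<forall>i<N. f i \<in> A" "a \<in> A" "v = (\<Sum>i<N. f i) + a"
    unfolding sumset_def by blast
  then have "v = (\<Sum>i<Suc N. (f(N := a)) i)" "\<forall>i<Suc N. (f(N := a)) i \<in> A"
    by (auto simp: less_Suc_eq)
  then show "v \<in> sumset (Suc N) A"
    unfolding sumset_def by blast
qed

lemma sumset_add:
  assumes "v \<in> sumset N A" "w \<in> sumset M A"
  shows "v + w \<in> sumset (N + M) A"
  using assms(2)
proof (induction M arbitrary: w)
  case 0
  then show ?case using assms(1) by simp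
next
  case (Suc M)
  then obtain u a where "u \<in> sumset M A" "a \<in> A" "w = u + a"
    by (auto simp: sumset_Suc)
  then show ?case
    using Suc.IH[of u] by (auto simp: sumset_Suc add.assoc[symmetric])
qed

lemma scale_mem_sumset: "a \<in> A \<Longrightarrow> real k *\<^sub>R a \<in> sumset k A"
proof (induction k)
  case (Suc k)
  then show ?case
    unfolding sumset_Suc
    by (intro bexI[of _ "real k *\<^sub>R a"] bexI[of _ a]) (auto simp: algebra_simps)
qed simp

lemma nat_sum_mem_sumset:
  assumes "finite X" "X \<subseteq> A"
  shows "(\<Sum>x\<in>X. real (m x) *\<^sub>R x) \<in> sumset (\<Sum>x\<in>X. m x) A"
  using assms by (induction X rule: finite_induct) (auto intro: sumset_add scale_mem_sumset)

text \<open>\<open>m x\<close> counts how often \<open>x\<close> is used; one more summand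
  \<open>a\<close> raises \<open>m a\<close> by one.\<close>

lemma sumset_imp_nat_sum:
  assumes "finite A" "v \<in> sumset N A"
  obtains m where "v = (\<Sum>x\<in>A. real (m x) *\<^sub>R x)" "(\<Sum>x\<in>A. m x) = N"
  using assms(2)
proof (induction N arbitrary: v thesis)
  case 0
  show ?case using 0(1)[of "\<lambda>_. 0"] 0(2) by simp
next
  case (Suc N)
  then obtain w a where w: "w \<in> sumset N A" "a \<in> A" "v = w + a"
    by (auto simp: sumset_Suc)
  obtain m where m: "w = (\<Sum>x\<in>A. real (m x) *\<^sub>R x)" "(\<Sum>x\<in>A. m x) = N"
    using Suc.IH[OF _ w(1)] by blast
  have split: "real (m x + of_bool (x = a)) *\<^sub>R x = real (m x) *\<^sub>R x + (if x = a then x else 0)" for x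
    by (simp add: algebra_simps)
  show ?case
  proof (rule Suc.prems(1)[of "\<lambda>x. m x + of_bool (x = a)"])
    show "v = (\<Sum>x\<in>A. real (m x + of_bool (x = a)) *\<^sub>R x)"
      unfolding split sum.distrib using assms(1) w m(1) by simp
    show "(\<Sum>x\<in>A. m x + of_bool (x = a)) = Suc N"
      unfolding sum.distrib using assms(1) w m(2) by (simp add: of_bool_def)
  qed
qed

section \<open>The reflection of \<open>A\<close> in one of its points\<close>

lemma sum_reflect:
  fixes A :: "(real ^ 'n) set"
  shows "(\<Sum>y\<in>(\<lambda>x. a - x) ` A. g y *\<^sub>R y) = (\<Sum>x\<in>A. g (a - x) *\<^sub>R (a - x))"
  by (subst sum.reindex) (auto simp: inj_on_def)

lemma sum_scale_diff:
  fixes A :: "(real ^ 'n) set" and c :: "real ^ 'n \<Rightarrow> real"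
  shows "(\<Sum>x\<in>A. c x *\<^sub>R (a - x)) = (\<Sum>x\<in>A. c x) *\<^sub>R a - (\<Sum>x\<in>A. c x *\<^sub>R x)"
  by (simp add: scaleR_diff_right sum_subtractf scaleR_sum_left)

text \<open>The vector equals the sum of \<open>c x *\<^sub>R (a - x)\<close>. The reflection is its
  own inverse, so the element \<open>y\<close> of \<open>a - A\<close> carries the coefficient
  \<open>c (a - y)\<close>.\<close>

lemma reflect_mem_gen_cone:
  assumes "\<forall>x\<in>A. 0 \<le> c x"
  shows "(\<Sum>x\<in>A. c x) *\<^sub>R a - (\<Sum>x\<in>A. c x *\<^sub>R x) \<in> gen_cone ((\<lambda>x. a - x) ` A)"
proof -
  have "(\<Sum>x\<in>A. c x) *\<^sub>R a - (\<Sum>x\<in>A. c x *\<^sub>R x) = (\<Sum>y\<in>(\<lambda>x. a - x) ` A. c (a - y) *\<^sub>R y)"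
    using sum_reflect[of "\<lambda>y. c (a - y)" a A] by (simp add: sum_scale_diff)
  then show ?thesis
    using assms unfolding gen_cone_def by (intro CollectI exI[of _ "\<lambda>y. c (a - y)"]) auto
qed

lemma reflect_mem_nat_comb:
  assumes "finite A" "v \<in> sumset N A"
  shows "real N *\<^sub>R a - v \<in> nat_comb ((\<lambda>x. a - x) ` A)"
proof -
  obtain m where m: "v = (\<Sum>x\<in>A. real (m x) *\<^sub>R x)" "(\<Sum>x\<in>A. m x) = N"
    using sumset_imp_nat_sum[OF assms] by blast
  have "real N *\<^sub>R a - v = (\<Sum>y\<in>(\<lambda>x. a - x) ` A. real (m (a - y)) *\<^sub>R y)"
    using sum_reflect[of "\<lambda>y. real (m (a - y))" a A] sum_scale_diff[of "\<lambda>x. real (m x)" a A] m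
    by auto
  then show ?thesis
    unfolding nat_comb_def by (intro CollectI exI[of _ "\<lambda>y. m (a - y)"]) auto
qed

text \<open>If \<open>N a - v\<close> is the sum of \<open>q (a - x)\<close> copies of
  \<open>a - x\<close>, moving the \<open>k\<close> copies of \<open>a\<close> to the other side
  writes \<open>v + k a\<close> as \<open>N\<close> copies of \<open>a\<close> plus \<open>k\<close>
  elements of \<open>A\<close>. Nothing bounds \<open>k\<close> by \<open>N\<close>, so the copies
  of \<open>a\<close> cannot simply be cancelled; hence the shift.\<close>

lemma sumset_shift_of_reflect:
  assumes "finite A" "a \<in> A" "real N *\<^sub>R a - v \<in> nat_comb ((\<lambda>x. a - x) ` A)"
  obtains k where "v + real k *\<^sub>R a \<in> sumset (N + k) A"
proof -
  obtain q where "real N *\<^sub>R a - v = (\<Sum>y\<in>(\<lambda>x. a - x) ` A. real (q y) *\<^sub>R y)"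
    using assms(3) unfolding nat_comb_def by blast
  then have "real N *\<^sub>R a - v = (\<Sum>x\<in>A. real (q (a - x)) *\<^sub>R (a - x))"
    by (simp add: sum_reflect)
  then have "v + real (\<Sum>x\<in>A. q (a - x)) *\<^sub>R a = real N *\<^sub>R a + (\<Sum>x\<in>A. real (q (a - x)) *\<^sub>R x)"
    unfolding sum_scale_diff by (simp add: algebra_simps)
  moreover have "\<dots> \<in> sumset (N + (\<Sum>x\<in>A. q (a - x))) A"
    using assms(1,2) by (intro sumset_add scale_mem_sumset nat_sum_mem_sumset) auto
  ultimately show ?thesis by (intro that[of "\<Sum>x\<in>A. q (a - x)"]) simp
qed

section \<open>Scaled hulls and the inclusion valid for every \<open>N\<close>\<close>

lemma scaled_hull_coeffs:
  assumes "finite A" "v \<in> (\<lambda>y. real N *\<^sub>R y) ` (convex hull A)"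
  obtains c where "\<forall>x\<in>A. (0::real) \<le> c x" "(\<Sum>x\<in>A. c x) = real N" "v = (\<Sum>x\<in>A. c x *\<^sub>R x)"
proof -
  obtain u where "\<forall>x\<in>A. 0 \<le> u x" "sum u A = 1" "v = real N *\<^sub>R (\<Sum>x\<in>A. u x *\<^sub>R x)"
    using assms by (auto simp: convex_hull_finite)
  then show ?thesis
    by (intro that[of "\<lambda>x. real N * u x"])
      (auto simp: sum_distrib_left[symmetric] scaleR_right.sum)
qed

text \<open>Multiplicities divided by \<open>N\<close> are convex coefficients. For
  \<open>N = 0\<close> both sets are \<open>{0}\<close>, the hull being nonempty.\<close>

lemma sumset_subset_scaled_hull:
  assumes "finite A" "A \<noteq> {}" "v \<in> sumset N A"
  shows "v \<in> (\<lambda>y. real N *\<^sub>R y) ` (convex hull A)"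
proof (cases "N = 0")
  case True
  then show ?thesis using assms(2,3) by (auto simp: image_constant_conv)
next
  case False
  obtain m where m: "v = (\<Sum>x\<in>A. real (m x) *\<^sub>R x)" "(\<Sum>x\<in>A. m x) = N"
    using sumset_imp_nat_sum[OF assms(1,3)] by blast
  let ?u = "\<lambda>x. real (m x) / real N"
  have "(\<Sum>x\<in>A. ?u x) = 1"
    using m(2) False by (simp add: sum_divide_distrib[symmetric] of_nat_sum[symmetric])
  then have "(\<Sum>x\<in>A. ?u x *\<^sub>R x) \<in> convex hull A"
    unfolding convex_hull_finite[OF assms(1)] by (intro CollectI exI[of _ ?u]) simp
  moreover have "v = real N *\<^sub>R (\<Sum>x\<in>A. ?u x *\<^sub>R x)"
    using False by (simp add: m(1) scaleR_right.sum)
  ultimately show ?thesis by blast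
qed

text \<open>A representation of \<open>v\<close> by \<open>N\<close> summands exhibits
  \<open>v\<close> in \<open>nat_comb A\<close> and, after reflection, \<open>N a - v\<close> in
  \<open>nat_comb (a - A)\<close>, so neither is exceptional.\<close>

lemma sumset_subset_structure:
  assumes "finite A" "A \<subseteq> int_lattice" "A \<noteq> {}" "v \<in> sumset N A"
  shows "v \<in> (((\<lambda>y. real N *\<^sub>R y) ` (convex hull A)) \<inter> int_lattice) - exceptional_level N A"
proof -
  obtain m where m: "v = (\<Sum>x\<in>A. real (m x) *\<^sub>R x)"
    using sumset_imp_nat_sum[OF assms(1,4)] by blast
  have "v \<in> int_lattice"
    unfolding m using assms(2) by (intro int_lattice_sum int_lattice_scale) auto
  moreover have "v \<notin> exceptional A"
    using m by (auto simp: exceptional_def nat_comb_def)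
  moreover have "v \<notin> (\<lambda>y. real N *\<^sub>R a - y) ` exceptional ((\<lambda>x. a - x) ` A)" for a
    using reflect_mem_nat_comb[OF assms(1,4), of a] by (auto simp: exceptional_def)
  ultimately show ?thesis
    using sumset_subset_scaled_hull[OF assms(1,3,4)] by (auto simp: exceptional_level_def)
qed

section \<open>Witness sets for a fixed remainder\<close>

text \<open>The set \<open>T\<close> of the proof idea for given \<open>(r, s)\<close>. Values of
  \<open>m\<close> outside \<open>A\<close> do not affect membership.\<close>

definition sum_witnesses :: "(real ^ 'n) set \<Rightarrow> real ^ 'n \<Rightarrow> nat \<Rightarrow> (real ^ 'n \<Rightarrow> nat) set" where
  "sum_witnesses A r s = {m. r + (\<Sum>x\<in>A. real (m x) *\<^sub>R x) \<in> sumset (s + (\<Sum>x\<in>A. m x)) A}"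

text \<open>Adding the surplus \<open>m x - t x\<close> copies of each \<open>x\<close> changes the
  point and the number of summands in step. The subtraction is exact since \<open>t \<le> m\<close>
  on \<open>A\<close>.\<close>

lemma sum_witnesses_up_closed:
  assumes "finite A" "t \<in> sum_witnesses A r s" "\<forall>x\<in>A. t x \<le> m x"
  shows "m \<in> sum_witnesses A r s"
proof -
  let ?d = "\<lambda>x. m x - t x"
  have "r + (\<Sum>x\<in>A. real (t x) *\<^sub>R x) + (\<Sum>x\<in>A. real (?d x) *\<^sub>R x)
      \<in> sumset (s + (\<Sum>x\<in>A. t x) + (\<Sum>x\<in>A. ?d x)) A"
    by (rule sumset_add[OF _ nat_sum_mem_sumset[OF assms(1) subset_refl]])
      (use assms(2) in \<open>simp add: sum_witnesses_def\<close>)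
  moreover have "(\<Sum>x\<in>A. real (t x) *\<^sub>R x) + (\<Sum>x\<in>A. real (?d x) *\<^sub>R x) = (\<Sum>x\<in>A. real (m x) *\<^sub>R x)"
    unfolding sum.distrib[symmetric] using assms(3)
    by (intro sum.cong) (auto simp: scaleR_left_distrib[symmetric])
  moreover have "(\<Sum>x\<in>A. t x) + (\<Sum>x\<in>A. ?d x) = (\<Sum>x\<in>A. m x)"
    unfolding sum.distrib[symmetric] using assms(3) by (intro sum.cong) auto
  ultimately show ?thesis
    unfolding sum_witnesses_def add.assoc mem_Collect_eq by simp
qed

text \<open>Only finitely many pairs \<open>(r, s)\<close> are allowed, so the maximum of their
  individual bounds serves for all of them.\<close>

lemma sum_witnesses_stabilise:
  assumes "finite A" "finite R"
  obtains M where "\<And>r s m b k. r \<in> R \<Longrightarrow> s \<le> S \<Longrightarrow> b \<in> A \<Longrightarrow> M \<le> m b \<Longrightarrow>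
      m(b := m b + k) \<in> sum_witnesses A r s \<Longrightarrow> m \<in> sum_witnesses A r s"
proof -
  have "\<forall>p. \<exists>M. \<forall>m. \<forall>b\<in>A. \<forall>k. M \<le> m b \<longrightarrow>
      m(b := m b + k) \<in> sum_witnesses A (fst p) (snd p) \<longrightarrow> m \<in> sum_witnesses A (fst p) (snd p)"
    by (rule allI, rule up_closed_stabilises[OF assms(1)]) (rule sum_witnesses_up_closed[OF assms(1)])
  from choice[OF this] obtain f where f: "\<And>p m b k. b \<in> A \<Longrightarrow> f p \<le> m b \<Longrightarrow>
      m(b := m b + k) \<in> sum_witnesses A (fst p) (snd p) \<Longrightarrow> m \<in> sum_witnesses A (fst p) (snd p)"
    by blast
  obtain M where M: "\<forall>p\<in>R \<times> {..S}. f p \<le> M"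
    using finite_nat_set_iff_bounded_le[of "f ` (R \<times> {..S})"] assms(2) by auto
  show ?thesis
  proof (rule that[of M])
    fix r s m b k
    assume *: "r \<in> R" "s \<le> S" "b \<in> A" "M \<le> m b" "m(b := m b + k) \<in> sum_witnesses A r s"
    then have "f (r, s) \<le> M" using M by blast
    with * have "f (r, s) \<le> m b" by linarith
    then show "m \<in> sum_witnesses A r s" using f[of b "(r, s)" m k] * by simp
  qed
qed

section \<open>The inclusion that needs large \<open>N\<close>\<close>

lemma sum_fun_upd_add:
  fixes g :: "'a \<Rightarrow> nat \<Rightarrow> 'b::comm_monoid_add"
  assumes "finite A" "b \<in> A"
  shows "(\<Sum>x\<in>A. g x ((m(b := n)) x)) = g b n + (\<Sum>x\<in>A - {b}. g x (m x))"
proof -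
  have "(\<Sum>x\<in>A - {b}. g x ((m(b := n)) x)) = (\<Sum>x\<in>A - {b}. g x (m x))"
    by (rule sum.cong) auto
  then show ?thesis
    using sum.remove[OF assms, of "\<lambda>x. g x ((m(b := n)) x)"] by simp
qed

lemma structure_subset_sumset:
  fixes A :: "(real ^ 'n) set"
  assumes fin: "finite A" and int: "A \<subseteq> int_lattice"
  shows "\<exists>N\<^sub>A::nat. \<forall>N\<ge>N\<^sub>A. \<forall>v.
      v \<in> (((\<lambda>y. real N *\<^sub>R y) ` (convex hull A)) \<inter> int_lattice) - exceptional_level N A
      \<longrightarrow> v \<in> sumset N A"
proof -
  \<comment> \<open>The remainder is a combination of \<open>A\<close> with the fractional parts of
    the \<open>c x\<close> as coefficients; this gives the norm bound, and makes the set of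
    remainders finite and independent of \<open>N\<close>.\<close>
  let ?R = "{r \<in> int_lattice. norm r \<le> (\<Sum>x\<in>A. norm x)}"
  obtain M where M: "\<And>r s m b k. r \<in> ?R \<Longrightarrow> s \<le> card A \<Longrightarrow> b \<in> A \<Longrightarrow> M \<le> m b \<Longrightarrow>
      m(b := m b + k) \<in> sum_witnesses A r s \<Longrightarrow> m \<in> sum_witnesses A r s"
    using sum_witnesses_stabilise[OF fin finite_int_lattice_bounded, where S = "card A"] by blast
  have "v \<in> sumset N A"
    \<comment> \<open>If all \<open>m x\<close> were at most \<open>M\<close>, then \<open>N\<close>
      would be at most \<open>card A * M + card A\<close>, the last term accounting for
      rounding.\<close>
    if N: "card A * (M + 1) < N"
      and v: "v \<in> (((\<lambda>y. real N *\<^sub>R y) ` (convex hull A)) \<inter> int_lattice) - exceptional_level N A"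
    for N v
  proof -
    obtain c where c: "\<forall>x\<in>A. (0::real) \<le> c x" "(\<Sum>x\<in>A. c x) = real N" "v = (\<Sum>x\<in>A. c x *\<^sub>R x)"
      using v scaled_hull_coeffs[OF fin] by blast
    define m where "m = (\<lambda>x. nat \<lfloor>c x\<rfloor>)"
    have m: "real (m x) \<le> c x" "c x \<le> real (m x) + 1" if "x \<in> A" for x
      using c(1) that unfolding m_def by (simp, linarith)+
    define r where "r = v - (\<Sum>x\<in>A. real (m x) *\<^sub>R x)"
    define s where "s = N - (\<Sum>x\<in>A. m x)"
    \<comment> \<open>This makes the truncated subtraction defining \<open>s\<close> exact.\<close>
    have "real (\<Sum>x\<in>A. m x) \<le> real N"
      unfolding c(2)[symmetric] of_nat_sum using m(1) by (intro sum_mono) auto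
    then have "(\<Sum>x\<in>A. m x) \<le> N" by (simp only: of_nat_le_iff)
    then have sN: "s + (\<Sum>x\<in>A. m x) = N" by (simp add: s_def)
    have "(\<Sum>x\<in>A. c x) \<le> (\<Sum>x\<in>A. real (m x) + 1)"
      using m(2) by (intro sum_mono) auto
    then have Nle: "N \<le> (\<Sum>x\<in>A. m x) + card A"
      unfolding c(2) sum.distrib by (simp flip: of_nat_sum of_nat_add)
    have r_int: "r \<in> int_lattice"
      unfolding r_def using v int by (intro int_lattice_diff int_lattice_sum int_lattice_scale) auto
    have "r = (\<Sum>x\<in>A. (c x - real (m x)) *\<^sub>R x)"
      by (simp add: r_def c(3) scaleR_diff_left sum_subtractf)
    also have "norm \<dots> \<le> (\<Sum>x\<in>A. norm x)"
    proof (rule sum_norm_le)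
      fix x assume "x \<in> A"
      then have "\<bar>c x - real (m x)\<bar> \<le> 1" using m[of x] by linarith
      then show "norm ((c x - real (m x)) *\<^sub>R x) \<le> norm x"
        by (simp add: mult_left_le_one_le)
    qed
    finally have "norm r \<le> (\<Sum>x\<in>A. norm x)" .
    with r_int have r: "r \<in> ?R" by simp
    have s: "s \<le> card A" using Nle by (simp add: s_def)
    obtain b where b: "b \<in> A" "M \<le> m b"
    proof (rule ccontr)
      assume no: "\<not> thesis"
      have "m x \<le> M" if "x \<in> A" for x
        using no \<open>\<And>b. b \<in> A \<Longrightarrow> M \<le> m b \<Longrightarrow> thesis\<close> that by (cases "M \<le> m x") auto
      then have "(\<Sum>x\<in>A. m x) \<le> (\<Sum>x\<in>A. M)"
        by (rule sum_mono)
      then show False using N Nle by simp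
    qed
    \<comment> \<open>Once \<open>N b - v\<close> is known to lie in the lattice and in the cone of
      \<open>b - A\<close>, not being exceptional forces it into
      \<open>nat_comb (b - A)\<close>.\<close>
    have "real N *\<^sub>R b - v \<in> int_lattice"
      using v int b by (intro int_lattice_diff int_lattice_scale) auto
    moreover have "real N *\<^sub>R b - v \<in> gen_cone ((\<lambda>x. b - x) ` A)"
      using reflect_mem_gen_cone[OF c(1), of b] c(2,3) by simp
    moreover have "real N *\<^sub>R b - v \<notin> exceptional ((\<lambda>x. b - x) ` A)"
    proof
      assume "real N *\<^sub>R b - v \<in> exceptional ((\<lambda>x. b - x) ` A)"
      then have "v \<in> (\<lambda>y. real N *\<^sub>R b - y) ` exceptional ((\<lambda>x. b - x) ` A)"
        by (rule rev_image_eqI) simp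
      then show False using v b(1) by (auto simp: exceptional_level_def)
    qed
    ultimately have "real N *\<^sub>R b - v \<in> nat_comb ((\<lambda>x. b - x) ` A)"
      by (simp add: exceptional_def)
    then obtain k where k: "v + real k *\<^sub>R b \<in> sumset (N + k) A"
      using sumset_shift_of_reflect[OF fin b(1)] by blast
    \<comment> \<open>Since \<open>r\<close> and \<open>s\<close> complete \<open>m\<close> to
      \<open>v\<close> and \<open>N\<close>, the membership \<open>k\<close> says exactly that
      \<open>m(b := m b + k)\<close> is a witness; stabilisation then removes the extra
      \<open>k\<close>.\<close>
    have "(\<Sum>x\<in>A. real ((m(b := m b + k)) x) *\<^sub>R x) = (\<Sum>x\<in>A. real (m x) *\<^sub>R x) + real k *\<^sub>R b"
      using sum_fun_upd_add[OF fin b(1), of "\<lambda>x n. real n *\<^sub>R x" m "m b + k"]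
        sum.remove[OF fin b(1), of "\<lambda>x. real (m x) *\<^sub>R x"] by (simp add: algebra_simps)
    moreover have "(\<Sum>x\<in>A. (m(b := m b + k)) x) = (\<Sum>x\<in>A. m x) + k"
      using sum_fun_upd_add[OF fin b(1), of "\<lambda>x n. n" m "m b + k"]
        sum.remove[OF fin b(1), of m] by simp
    ultimately have "m(b := m b + k) \<in> sum_witnesses A r s"
      using k sN by (simp add: sum_witnesses_def r_def add.assoc[symmetric])
    then have "m \<in> sum_witnesses A r s" by (rule M[of r s b m k, OF r s b])
    then show ?thesis using sN by (simp add: sum_witnesses_def r_def)
  qed
  then show ?thesis by (intro exI[of _ "Suc (card A * (M + 1))"]) auto
qed

theorem theorem2:
  fixes A :: "(real ^ 'n) set"
  assumes "finite A"
    and "A \<subseteq> int_lattice"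
    and "0 \<in> A"
    and "int_module.span A = int_lattice"
  shows "\<exists>N\<^sub>A::nat. \<forall>N\<ge>N\<^sub>A.
           sumset N A =
             (((\<lambda>y. real N *\<^sub>R y) ` (convex hull A)) \<inter> int_lattice) - exceptional_level N A"
proof -
  obtain N\<^sub>A :: nat where *: "\<And>N v. N \<ge> N\<^sub>A \<Longrightarrow>
      v \<in> (((\<lambda>y. real N *\<^sub>R y) ` (convex hull A)) \<inter> int_lattice) - exceptional_level N A
      \<Longrightarrow> v \<in> sumset N A"
    using structure_subset_sumset[OF assms(1,2)] by blast
  have "A \<noteq> {}" using assms(3) by blast
  then show ?thesis
    using * sumset_subset_structure[OF assms(1,2)] by (intro exI[of _ N\<^sub>A]) blast
qed

end
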